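(* Let $k\ge1$, $t\in\mathbb{R}$ and $f\in C^\infty(\mathbb{R})$. Then $$\dim_{\mathrm{Top}}(V_{f,t}(E))=\dim_{\mathrm{Top}}(E)$$ for all $E\subset\{x=t\}\subset J^k(\mathbb{R})$. Moreover, the restriction $V_{f,t}|_{\{x=t\}}:\{x=t\}\to\{x=t\}$ is biLipschitz when $\{x=t\}$ is equipped with the restriction of the Carnot–Carathéodory distance $d_{cc}$.
   Context: Let $k\ge 1$ be an integer. The jet space Carnot group $J^k(\mathbb{R})$ is the set $\mathbb{R}^{k+2}$, with points written $(x,u_k,\ldots,u_0)$, equipped with the group operation $(x,u_k,\ldots,u_0)\odot(y,v_k,\ldots,v_0)=(x+y,w_k,\ldots,w_0)$, where $w_k=u_k+v_k$ and $w_s=u_s+v_s+\sum_{j=s+1}^k u_j\frac{y^{j-s}}{(j-s)!}$ for $s=0,\ldots,k-1$; inverses $p^{-1}$ are with respect to $\odot$. The horizontal bundle is framed by the left-invariant vector fields $X^{(k)}=\frac{\partial}{\partial x}+u_k\frac{\partial}{\partial u_{k-1}}+\cdots+u_1\frac{\partial}{\partial u_0}$ and $\frac{\partial}{\partial u_k}$, declared orthonormal; a horizontal curve is a curve that is absolutely continuous into $\mathbb{R}^{k+2}$ and whose derivative lies a.e. in the horizontal bundle. The Carnot–Carathéodory distance $d_{cc}(p,q)$ is the infimum of lengths of horizontal curves connecting $p$ to $q$; it induces the Euclidean topology. $\dim_{\mathrm{Top}}$ is topological (inductive) dimension. For $f\in C^\infty(\mathbb{R})$ and $x\in\mathbb{R}$,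 $j^k_x(f):=(x,f^{(k)}(x),f^{(k-1)}(x),\ldots,f(x))\in J^k(\mathbb{R})$. For $t\in\mathbb{R}$, $\{x=t\}:=\{(x,u_k,\ldots,u_0)\in J^k(\mathbb{R}):x=t\}$. For $f\in C^\infty(\mathbb{R})$ and $t\in\mathbb{R}$, the vertical mapping $V_{f,t}:J^k(\mathbb{R})\to\{x=t\}$ is $V_{f,t}(x,u_k,\ldots,u_0):=(x,u_k,\ldots,u_0)\odot j^k_{x-t}(f)^{-1}$. *)

theory Defs
  imports "HOL-Analysis.Analysis" "HOL-Algebra.Group"
begin

section \<open>Jet space Carnot groups\<close>

text \<open>
  A point \<open>(x, u\<^sub>k, \<dots>, u\<^sub>0)\<close> of \<open>J\<^sup>k(\<real>)\<close> is encoded as the pair \<open>(x, u)\<close> with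
  \<open>u i = u\<^sub>i\<close> for \<open>i \<le> k\<close> and \<open>u i = 0\<close> for \<open>i > k\<close>. The product topology of
  \<open>real \<times> (nat \<Rightarrow> real)\<close> restricts to the Euclidean topology of \<open>\<real>\<^sup>k\<^sup>+\<^sup>2\<close> on
  the set of these points.
\<close>

type_synonym jet = "real \<times> (nat \<Rightarrow> real)"

definition jet_space :: "nat \<Rightarrow> jet set" where
  "jet_space k = {p. \<forall>i>k. snd p i = 0}"

definition jet_slice :: "nat \<Rightarrow> real \<Rightarrow> jet set" where
  "jet_slice k t = {p \<in> jet_space k. fst p = t}"

text \<open>For \<open>s = k\<close> the sum below is empty, so that the last component is \<open>u\<^sub>k + v\<^sub>k\<close>.\<close>

definition jet_mult :: "nat \<Rightarrow> jet \<Rightarrow> jet \<Rightarrow> jet" where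
  "jet_mult k p q =
     (fst p + fst q,
      \<lambda>s. if s \<le> k
          then snd p s + snd q s + (\<Sum>j\<in>{s+1..k}. snd p j * (fst q ^ (j - s) / fact (j - s)))
          else 0)"

definition jet_group :: "nat \<Rightarrow> jet monoid" where
  "jet_group k = \<lparr>carrier = jet_space k, mult = jet_mult k, one = (0, \<lambda>_. 0)\<rparr>"

context
begin

private definition shift :: "nat \<Rightarrow> real \<Rightarrow> (nat \<Rightarrow> real) \<Rightarrow> nat \<Rightarrow> real" where
  "shift k y u s = (\<Sum>j\<in>{s..k}. u j * (y ^ (j - s) / fact (j - s)))"

private lemma jet_mult_shift:
  "jet_mult k p q = (fst p + fst q, \<lambda>s. if s \<le> k then shift k (fst q) (snd p) s + snd q s else 0)"
  by (auto simp: jet_mult_def shift_def fun_eq_iff sum.atLeast_Suc_atMost)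

private lemma exp_binomial:
  "(\<Sum>j\<in>{s..i}. (y ^ (i - j) / fact (i - j)) * (z ^ (j - s) / fact (j - s))) =
     ((y + z) ^ (i - s) / fact (i - s) :: real)" if "s \<le> i"
proof -
  have "(\<Sum>j\<in>{s..i}. (y ^ (i - j) / fact (i - j)) * (z ^ (j - s) / fact (j - s))) =
      (\<Sum>m\<le>i - s. (y ^ (i - s - m) / fact (i - s - m)) * (z ^ m / fact m))"
    by (rule sum.reindex_bij_witness[of _ "\<lambda>m. m + s" "\<lambda>j. j - s"]) (use that in auto)
  also have "\<dots> = (z + y) ^ (i - s) / fact (i - s)"
    unfolding binomial_ring sum_divide_distrib
    by (rule sum.cong) (auto simp: binomial_fact field_simps)
  finally show ?thesis by (simp add: add.commute)
qed

private lemma shift_shift: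
  "shift k z (\<lambda>s. if s \<le> k then shift k y u s + v s else 0) s = shift k (y + z) u s + shift k z v s"
proof -
  have "(\<Sum>j\<in>{s..k}. \<Sum>i\<in>{j..k}. u i * (y ^ (i - j) / fact (i - j)) * (z ^ (j - s) / fact (j - s)))
      = (\<Sum>i\<in>{s..k}. \<Sum>j\<in>{s..i}. u i * (y ^ (i - j) / fact (i - j)) * (z ^ (j - s) / fact (j - s)))"
    unfolding sum.Sigma[OF finite_atLeastAtMost ballI[OF finite_atLeastAtMost]]
    by (rule sum.reindex_bij_witness[of _ "\<lambda>(a,b). (b,a)" "\<lambda>(a,b). (b,a)"]) auto
  also have "\<dots> = shift k (y + z) u s"
    unfolding shift_def
    by (intro sum.cong refl) (simp only: mult.assoc sum_distrib_left[symmetric] exp_binomial atLeastAtMost_iff)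
  finally show ?thesis
    unfolding shift_def by (simp add: sum.distrib distrib_right sum_distrib_right del: times_divide_eq_right times_divide_times_eq)
qed

private lemma shift_0: "s \<le> k \<Longrightarrow> shift k 0 u s = u s"
  by (simp add: shift_def sum.atLeast_Suc_atMost power_0_left)

lemma group_jet_group: "group (jet_group k)"
proof (rule groupI; unfold jet_group_def; simp)
  fix p q assume "p \<in> jet_space k" "q \<in> jet_space k"
  show "jet_mult k p q \<in> jet_space k"
    by (simp add: jet_mult_def jet_space_def)
next
  show "(0, \<lambda>_. 0) \<in> jet_space k"
    by (simp add: jet_space_def)
next
  fix p q r
  show "jet_mult k (jet_mult k p q) r = jet_mult k p (jet_mult k q r)"
    by (auto simp: jet_mult_shift shift_shift fun_eq_iff)
next
  fix p assume "p \<in> jet_space k"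
  then show "jet_mult k (0, \<lambda>_. 0) p = p"
    by (auto simp: jet_mult_shift jet_space_def shift_def fun_eq_iff prod_eq_iff)
next
  fix p assume p: "p \<in> jet_space k"
  let ?q = "(- fst p, \<lambda>s. if s \<le> k then shift k (- fst p) (\<lambda>i. - snd p i) s + 0 else 0)"
  have "jet_mult k ?q p = (0, \<lambda>_. 0)"
    unfolding jet_mult_shift
    using shift_shift[of k "fst p" "- fst p" "\<lambda>i. - snd p i" "\<lambda>_. 0"]
    by (auto simp: fun_eq_iff shift_0) (simp add: shift_def)
  moreover have "?q \<in> jet_space k" by (simp add: jet_space_def)
  ultimately show "\<exists>q\<in>jet_space k. jet_mult k q p = (0, \<lambda>_. 0)" by blast
qed

end

section \<open>The Carnot--Caratheodory distance\<close>

text \<open>Tangent vectors are encoded like points: \<open>(a, b)\<close> stands for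
  \<open>a \<partial>/\<partial>x + \<Sum>i\<le>k. b i \<partial>/\<partial>u\<^sub>i\<close>. The frame consists of \<open>jet_X\<close> and \<open>jet_U\<close>
  \<open>= \<partial>/\<partial>u\<^sub>k\<close>.\<close>

definition jet_X :: "nat \<Rightarrow> jet \<Rightarrow> jet" where
  "jet_X k p = (1, \<lambda>i. if i < k then snd p (Suc i) else 0)"

definition jet_U :: "nat \<Rightarrow> jet" where
  "jet_U k = (0, \<lambda>i. if i = k then 1 else 0)"

definition jet_lincomb :: "real \<Rightarrow> jet \<Rightarrow> real \<Rightarrow> jet \<Rightarrow> jet" where
  "jet_lincomb \<alpha> v \<beta> w = (\<alpha> * fst v + \<beta> * fst w, \<lambda>i. \<alpha> * snd v i + \<beta> * snd w i)"

definition horizontal_space :: "nat \<Rightarrow> jet \<Rightarrow> jet set" where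
  "horizontal_space k p = {jet_lincomb \<alpha> (jet_X k p) \<beta> (jet_U k) | \<alpha> \<beta>. True}"

text \<open>The norm on the horizontal spaces for which the frame is orthonormal; the coefficients
  of a horizontal vector in the frame are its \<open>x\<close>- and \<open>u\<^sub>k\<close>-components.\<close>

definition horizontal_norm :: "nat \<Rightarrow> jet \<Rightarrow> real" where
  "horizontal_norm k v = sqrt ((fst v)\<^sup>2 + (snd v k)\<^sup>2)"

lemma horizontal_norm_frame:
  "horizontal_norm k (jet_lincomb \<alpha> (jet_X k p) \<beta> (jet_U k)) = sqrt (\<alpha>\<^sup>2 + \<beta>\<^sup>2)"
  by (simp add: horizontal_norm_def jet_lincomb_def jet_X_def jet_U_def)

definition abs_continuous_on :: "real \<Rightarrow> real \<Rightarrow> (real \<Rightarrow> real) \<Rightarrow> bool" where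
  "abs_continuous_on a b g \<longleftrightarrow>
     (\<forall>\<epsilon>>0. \<exists>\<delta>>0. \<forall>D T. D division_of T \<and> T \<subseteq> {a..b} \<and> (\<Sum>K\<in>D. Sup K - Inf K) < \<delta>
        \<longrightarrow> (\<Sum>K\<in>D. \<bar>g (Sup K) - g (Inf K)\<bar>) < \<epsilon>)"

definition has_jet_velocity :: "(real \<Rightarrow> jet) \<Rightarrow> jet \<Rightarrow> real \<Rightarrow> bool" where
  "has_jet_velocity \<gamma> v s \<longleftrightarrow>
     ((\<lambda>\<tau>. fst (\<gamma> \<tau>)) has_real_derivative fst v) (at s) \<and>
     (\<forall>i. ((\<lambda>\<tau>. snd (\<gamma> \<tau>) i) has_real_derivative snd v i) (at s))"

definition jet_velocity :: "(real \<Rightarrow> jet) \<Rightarrow> real \<Rightarrow> jet" where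
  "jet_velocity \<gamma> s = (deriv (\<lambda>\<tau>. fst (\<gamma> \<tau>)) s, \<lambda>i. deriv (\<lambda>\<tau>. snd (\<gamma> \<tau>) i) s)"

text \<open>Absolute continuity into \<open>\<real>\<^sup>k\<^sup>+\<^sup>2\<close> is absolute continuity of all components.\<close>

definition horizontal_curve :: "nat \<Rightarrow> real \<Rightarrow> real \<Rightarrow> (real \<Rightarrow> jet) \<Rightarrow> bool" where
  "horizontal_curve k a b \<gamma> \<longleftrightarrow>
     a \<le> b \<and> \<gamma> ` {a..b} \<subseteq> jet_space k \<and>
     abs_continuous_on a b (\<lambda>s. fst (\<gamma> s)) \<and>
     (\<forall>i\<le>k. abs_continuous_on a b (\<lambda>s. snd (\<gamma> s) i)) \<and>
     (AE s in lborel. s \<in> {a..b} \<longrightarrow> (\<exists>v\<in>horizontal_space k (\<gamma> s). has_jet_velocity \<gamma> v s))"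

definition horizontal_length :: "nat \<Rightarrow> real \<Rightarrow> real \<Rightarrow> (real \<Rightarrow> jet) \<Rightarrow> ennreal" where
  "horizontal_length k a b \<gamma> =
     (\<integral>\<^sup>+s\<in>{a..b}. ennreal (horizontal_norm k (jet_velocity \<gamma> s)) \<partial>lborel)"

text \<open>With values in \<open>[0, \<infinity>]\<close>, the infimum needs no prior knowledge that any two points are
  joined by a horizontal curve.\<close>

definition d_cc :: "nat \<Rightarrow> jet \<Rightarrow> jet \<Rightarrow> ennreal" where
  "d_cc k p q =
     Inf {horizontal_length k a b \<gamma> | a b \<gamma>. horizontal_curve k a b \<gamma> \<and> \<gamma> a = p \<and> \<gamma> b = q}"

definition biLipschitz ::
    "'a set \<Rightarrow> ('a \<Rightarrow> 'a \<Rightarrow> ennreal) \<Rightarrow> 'b set \<Rightarrow> ('b \<Rightarrow> 'b \<Rightarrow> ennreal) \<Rightarrow> ('a \<Rightarrow> 'b) \<Rightarrow> bool" where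
  "biLipschitz A d B d' F \<longleftrightarrow>
     F \<in> A \<rightarrow> B \<and>
     (\<exists>L\<ge>1. \<forall>p\<in>A. \<forall>q\<in>A. d' (F p) (F q) \<le> ennreal L * d p q \<and> d p q \<le> ennreal L * d' (F p) (F q))"

section \<open>Topological dimension\<close>

text \<open>The small inductive dimension: \<open>-1\<close> for the empty space, \<open>\<infinity>\<close> if there is no bound.\<close>

definition top_dim :: "'a topology \<Rightarrow> ereal" where
  "top_dim X = Inf {ereal (of_int n) | n. X dim_le n}"

section \<open>Vertical mappings\<close>

definition smooth :: "(real \<Rightarrow> real) \<Rightarrow> bool" where
  "smooth f \<longleftrightarrow> (\<forall>n. (deriv ^^ n) f differentiable_on UNIV)"

definition jet_of :: "nat \<Rightarrow> (real \<Rightarrow> real) \<Rightarrow> real \<Rightarrow> jet" where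
  "jet_of k f x = (x, \<lambda>i. if i \<le> k then (deriv ^^ i) f x else 0)"

definition vertical_map :: "nat \<Rightarrow> (real \<Rightarrow> real) \<Rightarrow> real \<Rightarrow> jet \<Rightarrow> jet" where
  "vertical_map k f t p =
     p \<otimes>\<^bsub>jet_group k\<^esub> inv\<^bsub>jet_group k\<^esub> (jet_of k f (fst p - t))"

end

theory Submission
  imports Defs
begin

text \<open>
  A point of \<open>{x = t}\<close> is multiplied by \<open>c\<inverse>\<close>, where \<open>c = j\<^sup>k\<^sub>0(f)\<close> lies in \<open>{x = 0}\<close>. Right
  multiplication by an element of \<open>{x = 0}\<close> just adds its jet coordinates, so \<open>V\<close> acts on the
  slice as a Euclidean translation and is a homeomorphism onto its image on every subset; this
  settles the topological dimension.

  For the metric part, \<open>{x = 0}\<close> is an abelian subgroup. Two points \<open>p\<close>, \<open>q\<close> of the same slice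
  differ by \<open>p\<inverse> q\<close> in that subgroup, which commutes with \<open>c\<close>, so that
  \<open>q c\<inverse> = p (p\<inverse> q) c\<inverse> = (p c\<inverse> p\<inverse>) q\<close>. Fixing \<open>p\<close> and varying \<open>q\<close>, the right
  translation \<open>V\<close> agrees on the whole slice with one left translation
  (\<open>slice_right_mult_eq_left_mult\<close>). Left translations are isometries of \<open>d_cc\<close>
  (\<open>d_cc_left_mult\<close>): multiplying by \<open>(a, b)\<close> on the left shifts \<open>x\<close> by \<open>a\<close> and adds to the jet
  coordinates the jet at \<open>x\<close> of the polynomial \<open>\<Sum>j\<le>k. b\<^sub>j x\<^sup>j / j!\<close>. Adding the jet of a
  polynomial preserves the equations \<open>u\<^sub>i' = u\<^sub>i\<^sub>+\<^sub>1 x'\<close> of a horizontal curve, and as the degree is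
  at most \<open>k\<close> the \<open>k\<close>-th derivative is constant, so that \<open>x'\<close> and \<open>u\<^sub>k'\<close>, and with them the
  length, are unchanged. Hence \<open>V\<close> is even isometric on the slice.
\<close>

section \<open>Absolutely continuous functions\<close>

lemma abs_continuous_on_imp_continuous_on:
  assumes "abs_continuous_on a b g"
  shows "continuous_on {a..b} g"
  unfolding continuous_on_iff
proof (intro ballI allI impI)
  fix x e :: real assume x: "x \<in> {a..b}" and e: "0 < e"
  obtain d where d: "d > 0" and ac: "\<And>D T. D division_of T \<Longrightarrow> T \<subseteq> {a..b} \<Longrightarrow>
      (\<Sum>K\<in>D. Sup K - Inf K) < d \<Longrightarrow> (\<Sum>K\<in>D. \<bar>g (Sup K) - g (Inf K)\<bar>) < e"
    using assms e unfolding abs_continuous_on_def by metis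
  have one_interval: "\<bar>g z - g y\<bar> < e" if "y \<in> {a..b}" "z \<in> {a..b}" "y \<le> z" "z - y < d" for y z
    using ac[of "{{y..z}}" "{y..z}"] division_of_self[of y z] that by auto
  have "dist (g y) (g x) < e" if "y \<in> {a..b}" "dist y x < d" for y
    using one_interval[of x y] one_interval[of y x] x that
    by (cases "x \<le> y") (auto simp: dist_real_def)
  then show "\<exists>d>0. \<forall>y\<in>{a..b}. dist y x < d \<longrightarrow> dist (g y) (g x) < e"
    using d by blast
qed

lemma abs_continuous_on_add:
  assumes "abs_continuous_on a b g" "abs_continuous_on a b h"
  shows "abs_continuous_on a b (\<lambda>s. g s + h s)"
  unfolding abs_continuous_on_def
proof (intro allI impI)
  fix e :: real assume e: "0 < e"
  obtain d1 where d1: "d1 > 0" and ac1: "\<And>D T. D division_of T \<Longrightarrow> T \<subseteq> {a..b} \<Longrightarrow>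
      (\<Sum>K\<in>D. Sup K - Inf K) < d1 \<Longrightarrow> (\<Sum>K\<in>D. \<bar>g (Sup K) - g (Inf K)\<bar>) < e/2"
    using assms(1) half_gt_zero[OF e] unfolding abs_continuous_on_def by metis
  obtain d2 where d2: "d2 > 0" and ac2: "\<And>D T. D division_of T \<Longrightarrow> T \<subseteq> {a..b} \<Longrightarrow>
      (\<Sum>K\<in>D. Sup K - Inf K) < d2 \<Longrightarrow> (\<Sum>K\<in>D. \<bar>h (Sup K) - h (Inf K)\<bar>) < e/2"
    using assms(2) half_gt_zero[OF e] unfolding abs_continuous_on_def by metis
  have "(\<Sum>K\<in>D. \<bar>g (Sup K) + h (Sup K) - (g (Inf K) + h (Inf K))\<bar>) < e"
    if "D division_of T" "T \<subseteq> {a..b}" "(\<Sum>K\<in>D. Sup K - Inf K) < min d1 d2" for D T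
  proof -
    have "(\<Sum>K\<in>D. \<bar>g (Sup K) + h (Sup K) - (g (Inf K) + h (Inf K))\<bar>)
        \<le> (\<Sum>K\<in>D. \<bar>g (Sup K) - g (Inf K)\<bar> + \<bar>h (Sup K) - h (Inf K)\<bar>)"
      by (rule sum_mono) linarith
    also have "\<dots> < e"
      using ac1[of D T] ac2[of D T] that by (simp add: sum.distrib)
    finally show ?thesis .
  qed
  then show "\<exists>d>0. \<forall>D T. D division_of T \<and> T \<subseteq> {a..b} \<and> (\<Sum>K\<in>D. Sup K - Inf K) < d
      \<longrightarrow> (\<Sum>K\<in>D. \<bar>g (Sup K) + h (Sup K) - (g (Inf K) + h (Inf K))\<bar>) < e"
    using d1 d2 by (intro exI[of _ "min d1 d2"]) auto
qed

lemma abs_continuous_on_lipschitz_compose: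
  assumes g: "abs_continuous_on a b g"
    and h: "\<And>x y. x \<in> g ` {a..b} \<Longrightarrow> y \<in> g ` {a..b} \<Longrightarrow> \<bar>h x - h y\<bar> \<le> L * \<bar>x - y\<bar>"
  shows "abs_continuous_on a b (\<lambda>s. h (g s))"
  unfolding abs_continuous_on_def
proof (intro allI impI)
  fix e :: real assume e: "0 < e"
  \<comment> \<open>A positive Lipschitz constant, to divide by.\<close>
  define M where "M = \<bar>L\<bar> + 1"
  have M: "M > 0" by (simp add: M_def)
  obtain d where d: "d > 0" and ac: "\<And>D T. D division_of T \<Longrightarrow> T \<subseteq> {a..b} \<Longrightarrow>
      (\<Sum>K\<in>D. Sup K - Inf K) < d \<Longrightarrow> (\<Sum>K\<in>D. \<bar>g (Sup K) - g (Inf K)\<bar>) < e/M"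
    using g divide_pos_pos[OF e M] unfolding abs_continuous_on_def by metis
  have "(\<Sum>K\<in>D. \<bar>h (g (Sup K)) - h (g (Inf K))\<bar>) < e"
    if D: "D division_of T" "T \<subseteq> {a..b}" "(\<Sum>K\<in>D. Sup K - Inf K) < d" for D T
  proof -
    have "\<bar>h (g (Sup K)) - h (g (Inf K))\<bar> \<le> M * \<bar>g (Sup K) - g (Inf K)\<bar>" if K: "K \<in> D" for K
    proof -
      obtain y z where yz: "K = {y..z}" "y \<le> z"
        using division_ofD(3,4)[OF D(1) K] by auto
      have "{y..z} \<subseteq> {a..b}"
        using division_ofD(2)[OF D(1) K] D(2) yz by blast
      with yz have "Sup K \<in> {a..b}" "Inf K \<in> {a..b}" by (auto simp: subset_eq)
      then have "\<bar>h (g (Sup K)) - h (g (Inf K))\<bar> \<le> L * \<bar>g (Sup K) - g (Inf K)\<bar>"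
        by (intro h) auto
      also have "\<dots> \<le> M * \<bar>g (Sup K) - g (Inf K)\<bar>"
        by (intro mult_right_mono) (auto simp: M_def)
      finally show ?thesis .
    qed
    then have "(\<Sum>K\<in>D. \<bar>h (g (Sup K)) - h (g (Inf K))\<bar>) \<le> M * (\<Sum>K\<in>D. \<bar>g (Sup K) - g (Inf K)\<bar>)"
      unfolding sum_distrib_left by (rule sum_mono)
    also have "\<dots> < e"
      using ac[OF D] M by (simp add: field_simps)
    finally show ?thesis .
  qed
  then show "\<exists>d>0. \<forall>D T. D division_of T \<and> T \<subseteq> {a..b} \<and> (\<Sum>K\<in>D. Sup K - Inf K) < d
      \<longrightarrow> (\<Sum>K\<in>D. \<bar>h (g (Sup K)) - h (g (Inf K))\<bar>) < e"
    using d by blast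
qed

text \<open>The range of \<open>g\<close> is bounded by continuity, and a \<open>C\<^sup>1\<close> function is Lipschitz on bounded
  intervals.\<close>

lemma abs_continuous_on_C1_compose:
  assumes g: "abs_continuous_on a b g"
    and h: "\<And>x. (h has_real_derivative h' x) (at x)" and h': "continuous_on UNIV h'"
  shows "abs_continuous_on a b (\<lambda>s. h (g s))"
proof -
  have "bounded (g ` {a..b})"
    by (intro compact_imp_bounded compact_continuous_image
        abs_continuous_on_imp_continuous_on g compact_Icc)
  then obtain R where R: "g ` {a..b} \<subseteq> {-R..R}"
    unfolding bounded_real by (auto simp: abs_le_iff) force
  have "bounded (h' ` {-R..R})"
    by (intro compact_imp_bounded compact_continuous_image continuous_on_subset[OF h'] compact_Icc) auto
  then obtain L where L: "\<And>x. x \<in> {-R..R} \<Longrightarrow> \<bar>h' x\<bar> \<le> L"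
    unfolding bounded_real by blast
  have "\<bar>h x - h y\<bar> \<le> L * \<bar>x - y\<bar>" if "x \<in> g ` {a..b}" "y \<in> g ` {a..b}" for x y
  proof -
    have "x \<in> {-R..R}" "y \<in> {-R..R}" using that R by blast+
    then have "norm (h x - h y) \<le> L * norm (x - y)"
      using L by (intro field_differentiable_bound[of "{-R..R}" h h' L]
          has_field_derivative_at_within[OF h]) auto
    then show ?thesis by simp
  qed
  with g show ?thesis by (rule abs_continuous_on_lipschitz_compose)
qed

section \<open>Left invariance of the Carnot--Caratheodory distance\<close>

text \<open>The \<open>s\<close>-th derivative at \<open>x\<close> of the polynomial \<open>\<Sum>j\<le>k. b\<^sub>j x\<^sup>j / j!\<close>, that is, of the
  polynomial of degree at most \<open>k\<close> with jet \<open>b\<close> at \<open>0\<close>.\<close>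

definition poly_jet :: "nat \<Rightarrow> (nat \<Rightarrow> real) \<Rightarrow> nat \<Rightarrow> real \<Rightarrow> real" where
  "poly_jet k b s x = (\<Sum>j\<in>{s..k}. b j * (x ^ (j - s) / fact (j - s)))"

lemma poly_jet_top: "poly_jet k b k x = b k"
  by (simp add: poly_jet_def)

lemma poly_jet_above: "s > k \<Longrightarrow> poly_jet k b s x = 0"
  by (simp add: poly_jet_def)

lemma has_real_derivative_poly_jet:
  "(poly_jet k b s has_real_derivative poly_jet k b (Suc s) x) (at x)"
proof (cases "s \<le> k")
  case True
  have split: "poly_jet k b s = (\<lambda>x. b s + (\<Sum>j\<in>{Suc s..k}. b j * (x ^ (j - s) / fact (j - s))))"
    using True by (simp add: poly_jet_def fun_eq_iff sum.atLeast_Suc_atMost)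
  have summand: "((\<lambda>x. b j * (x ^ (j - s) / fact (j - s))) has_real_derivative
      b j * (x ^ (j - Suc s) / fact (j - Suc s))) (at x)" if "j \<in> {Suc s..k}" for j
  proof -
    define m where "m = j - Suc s"
    then have m: "j - s = Suc m" "j - Suc s = m"
      using that by auto
    have "((\<lambda>x. b j * (x ^ Suc m / fact (Suc m))) has_real_derivative
        b j * (real (Suc m) * x ^ m / fact (Suc m))) (at x)"
      using DERIV_pow[of "Suc m" x UNIV] by (intro DERIV_cmult DERIV_cdivide) simp
    then show ?thesis
      unfolding m by (simp add: fact_Suc del: of_nat_Suc)
  qed
  have "((\<lambda>x. b s + (\<Sum>j\<in>{Suc s..k}. b j * (x ^ (j - s) / fact (j - s)))) has_real_derivative
      0 + poly_jet k b (Suc s) x) (at x)"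
    unfolding poly_jet_def by (intro DERIV_add DERIV_const DERIV_sum summand)
  then show ?thesis by (simp add: split)
next
  case False
  then have "poly_jet k b s = (\<lambda>_. 0)" "poly_jet k b (Suc s) x = 0"
    by (auto simp: poly_jet_above fun_eq_iff)
  then show ?thesis by simp
qed

lemma continuous_on_poly_jet: "continuous_on S (poly_jet k b s)"
  by (rule DERIV_continuous_on) (rule has_field_derivative_at_within[OF has_real_derivative_poly_jet])

lemma jet_mult_poly_jet:
  "jet_mult k g p =
     (fst g + fst p, \<lambda>s. if s \<le> k then snd p s + poly_jet k (snd g) s (fst p) else 0)"
  by (auto simp: jet_mult_def poly_jet_def fun_eq_iff sum.atLeast_Suc_atMost)

lemma carrier_jet_group: "carrier (jet_group k) = jet_space k"
  and mult_jet_group: "x \<otimes>\<^bsub>jet_group k\<^esub> y = jet_mult k x y"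
  by (simp_all add: jet_group_def)

text \<open>Along a horizontal curve \<open>u\<^sub>i' = u\<^sub>i\<^sub>+\<^sub>1 x'\<close> for \<open>i < k\<close>. Left multiplication adds \<open>P\<^sup>(\<^sup>i\<^sup>)(x)\<close>
  to \<open>u\<^sub>i\<close>, with \<open>P\<close> a polynomial of degree at most \<open>k\<close>. These summands satisfy
  the same equations by the chain rule, and \<open>P\<^sup>(\<^sup>k\<^sup>)\<close> is constant.\<close>

lemma left_mult_velocity:
  assumes v: "v \<in> horizontal_space k (\<gamma> s)" "has_jet_velocity \<gamma> v s"
  obtains w where "w \<in> horizontal_space k (jet_mult k g (\<gamma> s))"
    "has_jet_velocity (\<lambda>\<tau>. jet_mult k g (\<gamma> \<tau>)) w s" "fst w = fst v" "snd w k = snd v k"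
proof -
  obtain \<alpha> \<beta> where v_eq: "v = jet_lincomb \<alpha> (jet_X k (\<gamma> s)) \<beta> (jet_U k)"
    using v(1) by (auto simp: horizontal_space_def)
  define w where "w = jet_lincomb \<alpha> (jet_X k (jet_mult k g (\<gamma> s))) \<beta> (jet_U k)"
  have fst_v: "fst v = \<alpha>" by (simp add: v_eq jet_lincomb_def jet_X_def jet_U_def)
  have w: "w \<in> horizontal_space k (jet_mult k g (\<gamma> s))"
    by (auto simp: horizontal_space_def w_def)
  have frame_coeffs: "fst w = fst v" "snd w k = snd v k"
    by (simp_all add: v_eq w_def jet_lincomb_def jet_X_def jet_U_def)
  have x': "((\<lambda>\<tau>. fst (\<gamma> \<tau>)) has_real_derivative \<alpha>) (at s)"
    and u': "\<And>i. ((\<lambda>\<tau>. snd (\<gamma> \<tau>) i) has_real_derivative snd v i) (at s)"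
    using v by (auto simp: has_jet_velocity_def fst_v)
  have "((\<lambda>\<tau>. snd (jet_mult k g (\<gamma> \<tau>)) i) has_real_derivative snd w i) (at s)" for i
  proof (cases "i \<le> k")
    case True
    have w_i: "snd w i = snd v i + poly_jet k (snd g) (Suc i) (fst (\<gamma> s)) * \<alpha>"
      using True
      by (cases "i = k")
        (auto simp: v_eq w_def jet_lincomb_def jet_X_def jet_U_def jet_mult_poly_jet
          poly_jet_above algebra_simps)
    show ?thesis
      using True unfolding w_i jet_mult_poly_jet
      by (auto intro!: DERIV_add u' DERIV_chain2[OF has_real_derivative_poly_jet x'])
  next
    case False
    then show ?thesis
      by (simp add: w_def jet_lincomb_def jet_X_def jet_U_def jet_mult_poly_jet)
  qed
  moreover have "((\<lambda>\<tau>. fst (jet_mult k g (\<gamma> \<tau>))) has_real_derivative fst w) (at s)"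
    using DERIV_add[OF DERIV_const[of "fst g"] x'] by (simp add: jet_mult_poly_jet frame_coeffs fst_v)
  ultimately have "has_jet_velocity (\<lambda>\<tau>. jet_mult k g (\<gamma> \<tau>)) w s"
    by (simp add: has_jet_velocity_def)
  with w frame_coeffs show ?thesis using that by blast
qed

lemma has_jet_velocity_imp_jet_velocity: "has_jet_velocity \<gamma> v s \<Longrightarrow> jet_velocity \<gamma> s = v"
  by (auto simp: has_jet_velocity_def jet_velocity_def prod_eq_iff fun_eq_iff DERIV_imp_deriv)

lemma horizontal_curve_left_mult:
  assumes "horizontal_curve k a b \<gamma>"
  shows "horizontal_curve k a b (\<lambda>s. jet_mult k g (\<gamma> s))"
proof -
  have x: "abs_continuous_on a b (\<lambda>s. fst (\<gamma> s))"
    and u: "\<And>i. i \<le> k \<Longrightarrow> abs_continuous_on a b (\<lambda>s. snd (\<gamma> s) i)"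
    and ae: "AE s in lborel. s \<in> {a..b} \<longrightarrow> (\<exists>v\<in>horizontal_space k (\<gamma> s). has_jet_velocity \<gamma> v s)"
    using assms by (auto simp: horizontal_curve_def)
  have "abs_continuous_on a b (\<lambda>s. fst g + fst (\<gamma> s))"
    by (rule abs_continuous_on_C1_compose[OF x, where h' = "\<lambda>_. 1"])
      (auto intro!: derivative_eq_intros)
  moreover have "abs_continuous_on a b (\<lambda>s. snd (\<gamma> s) i + poly_jet k (snd g) i (fst (\<gamma> s)))"
    if "i \<le> k" for i
    by (intro abs_continuous_on_add u that abs_continuous_on_C1_compose[OF x
        has_real_derivative_poly_jet continuous_on_poly_jet])
  moreover have "AE s in lborel. s \<in> {a..b} \<longrightarrow>
      (\<exists>w\<in>horizontal_space k (jet_mult k g (\<gamma> s)). has_jet_velocity (\<lambda>\<tau>. jet_mult k g (\<gamma> \<tau>)) w s)"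
    using ae by eventually_elim (metis left_mult_velocity)
  ultimately show ?thesis
    using assms by (auto simp: horizontal_curve_def jet_mult_poly_jet jet_space_def)
qed

lemma horizontal_length_left_mult:
  assumes "horizontal_curve k a b \<gamma>"
  shows "horizontal_length k a b (\<lambda>s. jet_mult k g (\<gamma> s)) = horizontal_length k a b \<gamma>"
proof -
  have "AE s in lborel. s \<in> {a..b} \<longrightarrow> (\<exists>v\<in>horizontal_space k (\<gamma> s). has_jet_velocity \<gamma> v s)"
    using assms by (auto simp: horizontal_curve_def)
  then have "AE s in lborel. s \<in> {a..b} \<longrightarrow>
      horizontal_norm k (jet_velocity (\<lambda>\<tau>. jet_mult k g (\<gamma> \<tau>)) s) = horizontal_norm k (jet_velocity \<gamma> s)"
    by eventually_elim
      (metis has_jet_velocity_imp_jet_velocity horizontal_norm_def left_mult_velocity)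
  then show ?thesis
    unfolding horizontal_length_def
    by (intro nn_integral_cong_AE) (auto elim!: eventually_mono simp: indicator_def)
qed

lemma d_cc_left_mult_le: "d_cc k (jet_mult k g p) (jet_mult k g q) \<le> d_cc k p q"
  unfolding d_cc_def
proof (rule Inf_greatest, safe)
  fix a b \<gamma> assume \<gamma>: "horizontal_curve k a b \<gamma>"
  show "Inf {horizontal_length k a' b' \<gamma>' |a' b' \<gamma>'. horizontal_curve k a' b' \<gamma>' \<and>
      \<gamma>' a' = jet_mult k g (\<gamma> a) \<and> \<gamma>' b' = jet_mult k g (\<gamma> b)} \<le> horizontal_length k a b \<gamma>"
    by (intro Inf_lower CollectI exI[of _ a] exI[of _ b] exI[of _ "\<lambda>s. jet_mult k g (\<gamma> s)"])
      (simp add: horizontal_curve_left_mult[OF \<gamma>] horizontal_length_left_mult[OF \<gamma>])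
qed

text \<open>The reverse inequality is the previous one for the inverse of \<open>g\<close>.\<close>

lemma d_cc_left_mult:
  assumes "g \<in> jet_space k" "p \<in> jet_space k" "q \<in> jet_space k"
  shows "d_cc k (jet_mult k g p) (jet_mult k g q) = d_cc k p q"
proof (rule antisym[OF d_cc_left_mult_le])
  interpret group "jet_group k" by (rule group_jet_group)
  let ?h = "inv\<^bsub>jet_group k\<^esub> g"
  have cancel: "jet_mult k ?h (jet_mult k g r) = r" if "r \<in> jet_space k" for r
    using assms(1) that by (simp flip: carrier_jet_group mult_jet_group m_assoc)
  show "d_cc k p q \<le> d_cc k (jet_mult k g p) (jet_mult k g q)"
    using d_cc_left_mult_le[of k ?h "jet_mult k g p" "jet_mult k g q"] assms
    by (simp add: cancel)
qed

section \<open>The action on a slice\<close>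

lemma jet_slice_subset: "p \<in> jet_slice k t \<Longrightarrow> p \<in> jet_space k"
  by (simp add: jet_slice_def)

lemma jet_mult_slice_zero:
  assumes "p \<in> jet_slice k t" "c \<in> jet_slice k 0"
  shows "jet_mult k p c = (t, \<lambda>s. snd p s + snd c s)"
proof -
  have "(\<Sum>j\<in>{s + 1..k}. snd p j * (0 ^ (j - s) / fact (j - s))) = (0::real)" for s
    by (rule sum.neutral) auto
  then show ?thesis
    using assms by (auto simp: jet_mult_def jet_slice_def jet_space_def fun_eq_iff)
qed

lemma inv_in_jet_slice_zero:
  assumes "c \<in> jet_slice k 0"
  shows "inv\<^bsub>jet_group k\<^esub> c \<in> jet_slice k 0"
proof -
  interpret group "jet_group k" by (rule group_jet_group)
  have "c \<in> carrier (jet_group k)" using assms by (simp add: carrier_jet_group jet_slice_subset)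
  then have "inv\<^bsub>jet_group k\<^esub> c \<in> jet_space k"
    "fst (jet_mult k c (inv\<^bsub>jet_group k\<^esub> c)) = fst \<one>\<^bsub>jet_group k\<^esub>"
    using inv_closed r_inv by (auto simp flip: carrier_jet_group mult_jet_group)
  then show ?thesis
    using assms by (auto simp: jet_slice_def jet_mult_def jet_group_def)
qed

lemma left_quotient_in_jet_slice_zero:
  assumes "p \<in> jet_slice k t" "q \<in> jet_slice k t"
  shows "inv\<^bsub>jet_group k\<^esub> p \<otimes>\<^bsub>jet_group k\<^esub> q \<in> jet_slice k 0"
proof -
  interpret group "jet_group k" by (rule group_jet_group)
  have mem: "p \<in> carrier (jet_group k)" "q \<in> carrier (jet_group k)"
    using assms by (simp_all add: carrier_jet_group jet_slice_subset)
  let ?d = "inv\<^bsub>jet_group k\<^esub> p \<otimes>\<^bsub>jet_group k\<^esub> q"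
  have p_d: "jet_mult k p ?d = q"
    using mem by (simp flip: mult_jet_group m_assoc)
  have "fst p + fst ?d = fst (jet_mult k p ?d)"
    by (simp add: jet_mult_def)
  then have "fst p + fst ?d = fst q"
    unfolding p_d .
  moreover have "?d \<in> jet_space k"
    using mem by (simp flip: carrier_jet_group)
  ultimately show ?thesis
    using assms by (simp add: jet_slice_def)
qed

text \<open>The abelian subgroup \<open>{x = 0}\<close> contains \<open>p\<inverse> q\<close> for any \<open>p\<close>, \<open>q\<close> in one slice, so
  \<open>g = p c p\<inverse>\<close> depends only on the slice of \<open>p\<close>.\<close>

lemma slice_right_mult_eq_left_mult:
  assumes c: "c \<in> jet_slice k 0"
  obtains g where "g \<in> jet_space k" "\<And>q. q \<in> jet_slice k t \<Longrightarrow> jet_mult k q c = jet_mult k g q"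
proof
  interpret group "jet_group k" by (rule group_jet_group)
  define p :: jet where "p = (t, \<lambda>_. 0)"
  have p: "p \<in> jet_slice k t" by (simp add: p_def jet_slice_def jet_space_def)
  have mem: "r \<in> carrier (jet_group k)" if "r \<in> jet_slice k t'" for r t'
    using that by (simp add: carrier_jet_group jet_slice_subset)
  let ?g = "p \<otimes>\<^bsub>jet_group k\<^esub> c \<otimes>\<^bsub>jet_group k\<^esub> inv\<^bsub>jet_group k\<^esub> p"
  show "?g \<in> jet_space k"
    using mem[OF p] mem[OF c] by (simp flip: carrier_jet_group)
  fix q assume q: "q \<in> jet_slice k t"
  let ?d = "inv\<^bsub>jet_group k\<^esub> p \<otimes>\<^bsub>jet_group k\<^esub> q"
  note d = left_quotient_in_jet_slice_zero[OF p q]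
  have comm: "c \<otimes>\<^bsub>jet_group k\<^esub> ?d = ?d \<otimes>\<^bsub>jet_group k\<^esub> c"
    unfolding mult_jet_group[of k c] mult_jet_group[of k _ c]
    by (simp add: jet_mult_slice_zero[OF c d] jet_mult_slice_zero[OF d c] add.commute)
  have "?g \<otimes>\<^bsub>jet_group k\<^esub> q = p \<otimes>\<^bsub>jet_group k\<^esub> (c \<otimes>\<^bsub>jet_group k\<^esub> ?d)"
    using mem[OF p] mem[OF c] mem[OF q] by (simp add: m_assoc)
  also have "\<dots> = q \<otimes>\<^bsub>jet_group k\<^esub> c"
    unfolding comm using mem[OF p] mem[OF c] mem[OF q] by (simp flip: m_assoc)
  finally show "jet_mult k q c = jet_mult k ?g q"
    by (simp add: mult_jet_group)
qed

lemma vertical_map_on_slice: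
  obtains c where "c \<in> jet_slice k 0" "\<And>p. p \<in> jet_slice k t \<Longrightarrow> vertical_map k f t p = jet_mult k p c"
proof
  show "inv\<^bsub>jet_group k\<^esub> (jet_of k f 0) \<in> jet_slice k 0"
    by (rule inv_in_jet_slice_zero) (simp add: jet_of_def jet_slice_def jet_space_def)
  show "vertical_map k f t p = jet_mult k p (inv\<^bsub>jet_group k\<^esub> (jet_of k f 0))"
    if "p \<in> jet_slice k t" for p
    using that by (simp add: vertical_map_def mult_jet_group jet_slice_def)
qed

lemma top_dim_homeomorphic: "X homeomorphic_space Y \<Longrightarrow> top_dim X = top_dim Y"
  by (simp add: top_dim_def homeomorphic_space_dimension_le)

lemma homeomorphic_space_translate_jets:
  fixes E :: "jet set" and d :: "nat \<Rightarrow> real"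
  shows "top_of_set ((\<lambda>p. (fst p, \<lambda>s. snd p s + d s)) ` E) homeomorphic_space top_of_set E"
proof -
  have cont: "continuous_on S (\<lambda>p :: jet. (fst p, \<lambda>s. snd p s + e s))" for S e
    by (intro continuous_intros continuous_on_product_then_coordinatewise)
  show ?thesis
    unfolding homeomorphic_space_def homeomorphic_maps_def
    using cont[of _ d] cont[of _ "\<lambda>s. - d s"]
    by (intro exI[of _ "\<lambda>p. (fst p, \<lambda>s. snd p s + - d s)"] exI[of _ "\<lambda>p. (fst p, \<lambda>s. snd p s + d s)"])
      (auto simp: continuous_map_in_subtopology continuous_map_from_subtopology)
qed

theorem proposition3p4:
  fixes k :: nat and t :: real and f :: "real \<Rightarrow> real"
  assumes "k \<ge> 1" and "smooth f"
  shows "(\<forall>E. E \<subseteq> jet_slice k t \<longrightarrow>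
             top_dim (top_of_set (vertical_map k f t ` E)) = top_dim (top_of_set E)) \<and>
         biLipschitz (jet_slice k t) (d_cc k) (jet_slice k t) (d_cc k) (vertical_map k f t)"
proof (intro conjI allI impI)
  obtain c where c: "c \<in> jet_slice k 0"
    and V: "\<And>p. p \<in> jet_slice k t \<Longrightarrow> vertical_map k f t p = jet_mult k p c"
    using vertical_map_on_slice by blast
  have V_translation: "vertical_map k f t p = (fst p, \<lambda>s. snd p s + snd c s)" if "p \<in> jet_slice k t" for p
    using that jet_mult_slice_zero[OF that c] by (simp add: V jet_slice_def)
  show "top_dim (top_of_set (vertical_map k f t ` E)) = top_dim (top_of_set E)"
    if "E \<subseteq> jet_slice k t" for E
  proof -
    have "vertical_map k f t ` E = (\<lambda>p. (fst p, \<lambda>s. snd p s + snd c s)) ` E"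
      using that by (intro image_cong refl V_translation) auto
    then show ?thesis
      by (simp add: top_dim_homeomorphic homeomorphic_space_translate_jets)
  qed
  obtain g where "g \<in> jet_space k" "\<And>q. q \<in> jet_slice k t \<Longrightarrow> jet_mult k q c = jet_mult k g q"
    using slice_right_mult_eq_left_mult[OF c] by blast
  then have "d_cc k (vertical_map k f t p) (vertical_map k f t q) = d_cc k p q"
    if "p \<in> jet_slice k t" "q \<in> jet_slice k t" for p q
    using that by (simp add: V d_cc_left_mult jet_slice_subset)
  moreover have "vertical_map k f t \<in> jet_slice k t \<rightarrow> jet_slice k t"
    using c by (auto simp: V_translation jet_slice_def jet_space_def)
  ultimately show "biLipschitz (jet_slice k t) (d_cc k) (jet_slice k t) (d_cc k) (vertical_map k f t)"
    unfolding biLipschitz_def by (auto intro!: exI[of _ 1])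
qed

end
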